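(* In $L(\mathfrak{sl}_2)^+$ define, for $i\geq 0$, $A^{\uparrow\uparrow}_i=x\otimes(t-1)^i$, $B^{\uparrow\uparrow}_i=(y\otimes t+z\otimes(t-1))(t-1)^i$, $\psi^{\uparrow\uparrow}_i=z\otimes(t-1)^i$. Then: (i) The elements $\{A^{\uparrow\uparrow}_i\}_{i\in\mathbb{N}}$ form a basis for $X^\sigma_{12}\cap O$. (ii) The elements $\{B^{\uparrow\uparrow}_i\}_{i\in\mathbb{N}}$ form a basis for $X^\sigma_{03}\cap O$. (iii) The elements $\{\psi^{\uparrow\uparrow}_{i+1}\}_{i\in\mathbb{N}}$ form a basis for $X^\sigma_{31}\cap O$.
   Context: $\mathbb{F}$ is a field of characteristic zero; $\mathbb{N}=\{0,1,2,\ldots\}$; $\mathbb{I}=\{0,1,2,3\}$; tensor products are over $\mathbb{F}$. The tetrahedron algebra $\boxtimes$ is the Lie algebra over $\mathbb{F}$ with generators $\{x_{ij}\mid i,j\in\mathbb{I},\ i\neq j\}$ and relations: $x_{ij}+x_{ji}=0$ for distinct $i,j$; $[x_{ij},x_{jk}]=2x_{ij}+2x_{jk}$ for mutually distinct $i,j,k$; $[x_{ij},[x_{ij},[x_{ij},x_{kh}]]]=4[x_{ij},x_{kh}]$ for mutually distinct $h,i,j,k$. For distinct $i,j\in\mathbb{I}$, $X_{ij}$ is the subspace of all $\xi\in\boxtimes$ ($x_{ij}$-like elements) with $[x_{ij},\xi]=0$ and $[x_{kh},[x_{kh},[x_{kh},\xi]]]=4[x_{kh},\xi]$, where $\{h,i,j,k\}=\mathbb{I}$;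 $X_{ij}=X_{ji}$. $\mathfrak{sl}_2$ has basis $e,f,h$ with $[h,e]=2e$, $[h,f]=-2f$, $[e,f]=h$, and equitable basis $x=2e-h$, $y=-2f-h$, $z=h$. $\mathcal{A}=\mathbb{F}[t,t^{-1},(t-1)^{-1}]$, $t$ an indeterminate, $t'=1-t^{-1}$, $t''=(1-t)^{-1}$. $L(\mathfrak{sl}_2)^+=\mathfrak{sl}_2\otimes\mathcal{A}$ with $[u\otimes a,v\otimes b]=[u,v]\otimes ab$; it is a right $\mathcal{A}$-module via $(u\otimes a)b=u\otimes ab$. $\sigma:\boxtimes\to L(\mathfrak{sl}_2)^+$ is the (unique) Lie algebra isomorphism with $x_{12}\mapsto x\otimes1$, $x_{23}\mapsto y\otimes1$, $x_{31}\mapsto z\otimes1$, $x_{03}\mapsto y\otimes t+z\otimes(t-1)$, $x_{01}\mapsto z\otimes t'+x\otimes(t'-1)$, $x_{02}\mapsto x\otimes t''+y\otimes(t''-1)$. $X^\sigma_{ij}$ denotes the image of $X_{ij}$ under $\sigma$. The Onsager Lie algebra $O$ (generators $A,B$; relations $[A,[A,[A,B]]]=4[A,B]$, $[B,[B,[B,A]]]=4[B,A]$) is identified with the Lie subalgebra of $L(\mathfrak{sl}_2)^+$ generated by $A=x\otimes1$ and $B=y\otimes t+z\otimes(t-1)$. *)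

theory Defs
  imports
    "HOL-Computational_Algebra.Computational_Algebra"
    "HOL-Library.Numeral_Type"
    "HOL-Library.Product_Plus"
begin

section \<open>Lie algebras\<close>

locale lie_algebra = vector_space scale
  for scale :: "'k::field \<Rightarrow> 'v::ab_group_add \<Rightarrow> 'v" +
  fixes bracket :: "'v \<Rightarrow> 'v \<Rightarrow> 'v"
  assumes bracket_add_left: "bracket (u + v) w = bracket u w + bracket v w"
    and bracket_add_right: "bracket u (v + w) = bracket u v + bracket u w"
    and bracket_scale_left: "bracket (scale c u) v = scale c (bracket u v)"
    and bracket_scale_right: "bracket u (scale c v) = scale c (bracket u v)"
    and bracket_self: "bracket u u = 0"
    and jacobi: "bracket u (bracket v w) + bracket v (bracket w u) + bracket w (bracket u v) = 0"

definition lie_isomorphism ::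
  "('k::field \<Rightarrow> 'v::ab_group_add \<Rightarrow> 'v) \<Rightarrow> ('v \<Rightarrow> 'v \<Rightarrow> 'v) \<Rightarrow>
   ('k \<Rightarrow> 'w::ab_group_add \<Rightarrow> 'w) \<Rightarrow> ('w \<Rightarrow> 'w \<Rightarrow> 'w) \<Rightarrow> ('v \<Rightarrow> 'w) \<Rightarrow> bool" where
  "lie_isomorphism s1 b1 s2 b2 \<phi> \<longleftrightarrow>
     lie_algebra s1 b1 \<and> lie_algebra s2 b2 \<and>
     Vector_Spaces.linear s1 s2 \<phi> \<and> (\<forall>u v. \<phi> (b1 u v) = b2 (\<phi> u) (\<phi> v)) \<and> bij \<phi>"

definition lie_subalgebra ::
  "('k::field \<Rightarrow> 'v::ab_group_add \<Rightarrow> 'v) \<Rightarrow> ('v \<Rightarrow> 'v \<Rightarrow> 'v) \<Rightarrow> 'v set \<Rightarrow> bool" where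
  "lie_subalgebra s b W \<longleftrightarrow> module.subspace s W \<and> (\<forall>u\<in>W. \<forall>v\<in>W. b u v \<in> W)"

definition lie_generated ::
  "('k::field \<Rightarrow> 'v::ab_group_add \<Rightarrow> 'v) \<Rightarrow> ('v \<Rightarrow> 'v \<Rightarrow> 'v) \<Rightarrow> 'v set \<Rightarrow> 'v set" where
  "lie_generated s b S = lie_subalgebra s b hull S"

definition family_basis ::
  "('k::field \<Rightarrow> 'v::ab_group_add \<Rightarrow> 'v) \<Rightarrow> ('i \<Rightarrow> 'v) \<Rightarrow> 'v set \<Rightarrow> bool" where
  "family_basis s v V \<longleftrightarrow>
     inj v \<and> \<not> module.dependent s (range v) \<and> module.span s (range v) = V"


section \<open>Lie algebras by generators and relations\<close>

datatype ('k, 'g) lie_term =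
    Gen 'g
  | Zero
  | Add "('k, 'g) lie_term" "('k, 'g) lie_term"
  | Neg "('k, 'g) lie_term"
  | Scale 'k "('k, 'g) lie_term"
  | Bracket "('k, 'g) lie_term" "('k, 'g) lie_term"

text \<open>The least congruence on terms that contains the given relations \<open>R\<close> and all instances of the
  axioms of a Lie algebra; the terms modulo this congruence are the Lie algebra presented by
  the generators \<open>'g\<close> and the relations \<open>R\<close>.\<close>

inductive lie_eq ::
  "(('k::field, 'g) lie_term \<Rightarrow> ('k, 'g) lie_term \<Rightarrow> bool) \<Rightarrow>
   ('k, 'g) lie_term \<Rightarrow> ('k, 'g) lie_term \<Rightarrow> bool" for R where
  rel: "R a b \<Longrightarrow> lie_eq R a b"
| refl: "lie_eq R a a"
| sym: "lie_eq R a b \<Longrightarrow> lie_eq R b a"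
| trans: "lie_eq R a b \<Longrightarrow> lie_eq R b c \<Longrightarrow> lie_eq R a c"
| Add_cong: "lie_eq R a a' \<Longrightarrow> lie_eq R b b' \<Longrightarrow> lie_eq R (Add a b) (Add a' b')"
| Neg_cong: "lie_eq R a a' \<Longrightarrow> lie_eq R (Neg a) (Neg a')"
| Scale_cong: "lie_eq R a a' \<Longrightarrow> lie_eq R (Scale r a) (Scale r a')"
| Bracket_cong: "lie_eq R a a' \<Longrightarrow> lie_eq R b b' \<Longrightarrow> lie_eq R (Bracket a b) (Bracket a' b')"
| Add_assoc: "lie_eq R (Add (Add a b) c) (Add a (Add b c))"
| Add_commute: "lie_eq R (Add a b) (Add b a)"
| Add_Zero: "lie_eq R (Add Zero a) a"
| Add_Neg: "lie_eq R (Add (Neg a) a) Zero"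
| Scale_Add: "lie_eq R (Scale r (Add a b)) (Add (Scale r a) (Scale r b))"
| Scale_plus: "lie_eq R (Scale (r + s) a) (Add (Scale r a) (Scale s a))"
| Scale_times: "lie_eq R (Scale r (Scale s a)) (Scale (r * s) a)"
| Scale_one: "lie_eq R (Scale 1 a) a"
| Bracket_Add_left: "lie_eq R (Bracket (Add a b) c) (Add (Bracket a c) (Bracket b c))"
| Bracket_Add_right: "lie_eq R (Bracket a (Add b c)) (Add (Bracket a b) (Bracket a c))"
| Bracket_Scale_left: "lie_eq R (Bracket (Scale r a) b) (Scale r (Bracket a b))"
| Bracket_Scale_right: "lie_eq R (Bracket a (Scale r b)) (Scale r (Bracket a b))"
| Bracket_self: "lie_eq R (Bracket a a) Zero"
| Jacobi: "lie_eq R (Add (Add (Bracket a (Bracket b c)) (Bracket b (Bracket c a)))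
                         (Bracket c (Bracket a b))) Zero"

lemma equivp_lie_eq: "equivp (lie_eq R)"
  by (rule equivpI)
    (auto intro!: reflpI sympI transpI intro: lie_eq.refl lie_eq.sym lie_eq.trans)


section \<open>The tetrahedron algebra\<close>

text \<open>The index set \<open>{0, 1, 2, 3}\<close> is the four-element type \<open>4\<close>.\<close>

typedef arc = "{p :: 4 \<times> 4. fst p \<noteq> snd p}"
  by (rule exI[of _ "(0, 1)"]) simp

text \<open>Meaningful for distinct \<open>i\<close> and \<open>j\<close> only, as are \<open>tet_x\<close> and \<open>tet_X\<close> below.\<close>

definition gen_x :: "4 \<Rightarrow> 4 \<Rightarrow> ('k, arc) lie_term" where
  "gen_x i j = Gen (Abs_arc (i, j))"

inductive tet_rel :: "('k::field, arc) lie_term \<Rightarrow> ('k, arc) lie_term \<Rightarrow> bool" where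
  "i \<noteq> j \<Longrightarrow> tet_rel (Add (gen_x i j) (gen_x j i)) Zero"
| "distinct [i, j, k] \<Longrightarrow>
     tet_rel (Bracket (gen_x i j) (gen_x j k)) (Add (Scale 2 (gen_x i j)) (Scale 2 (gen_x j k)))"
| "distinct [h, i, j, k] \<Longrightarrow>
     tet_rel (Bracket (gen_x i j) (Bracket (gen_x i j) (Bracket (gen_x i j) (gen_x k h))))
             (Scale 4 (Bracket (gen_x i j) (gen_x k h)))"

quotient_type (overloaded) 'k tetrahedron = "('k::field, arc) lie_term" / "lie_eq tet_rel"
  by (rule equivp_lie_eq)

instantiation tetrahedron :: (field) ab_group_add
begin

lift_definition zero_tetrahedron :: "'a tetrahedron" is Zero .
lift_definition plus_tetrahedron :: "'a tetrahedron \<Rightarrow> 'a tetrahedron \<Rightarrow> 'a tetrahedron" is Add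
  by (rule lie_eq.Add_cong)
lift_definition uminus_tetrahedron :: "'a tetrahedron \<Rightarrow> 'a tetrahedron" is Neg
  by (rule lie_eq.Neg_cong)
definition minus_tetrahedron :: "'a tetrahedron \<Rightarrow> 'a tetrahedron \<Rightarrow> 'a tetrahedron" where
  "minus_tetrahedron u v = u + - v"

instance
proof
  fix a b c :: "'a tetrahedron"
  show "a + b + c = a + (b + c)" by transfer (rule lie_eq.Add_assoc)
  show "a + b = b + a" by transfer (rule lie_eq.Add_commute)
  show "0 + a = a" by transfer (rule lie_eq.Add_Zero)
  show "- a + a = 0" by transfer (rule lie_eq.Add_Neg)
  show "a - b = a + - b" by (rule minus_tetrahedron_def)
qed

end

lift_definition tet_scale :: "'k::field \<Rightarrow> 'k tetrahedron \<Rightarrow> 'k tetrahedron" is Scale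
  by (rule lie_eq.Scale_cong)

lift_definition tet_bracket ::
  "'k::field tetrahedron \<Rightarrow> 'k tetrahedron \<Rightarrow> 'k tetrahedron" is Bracket
  by (rule lie_eq.Bracket_cong)

lift_definition tet_x :: "4 \<Rightarrow> 4 \<Rightarrow> 'k::field tetrahedron" is gen_x .

lemma lie_algebra_tetrahedron: "lie_algebra tet_scale (tet_bracket :: 'k::field tetrahedron \<Rightarrow> _)"
proof
  fix a b :: 'k and u v w :: "'k tetrahedron"
  show "tet_scale a (u + v) = tet_scale a u + tet_scale a v"
    by transfer (rule lie_eq.Scale_Add)
  show "tet_scale (a + b) u = tet_scale a u + tet_scale b u"
    by transfer (rule lie_eq.Scale_plus)
  show "tet_scale a (tet_scale b u) = tet_scale (a * b) u"
    by transfer (rule lie_eq.Scale_times)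
  show "tet_scale 1 u = u"
    by transfer (rule lie_eq.Scale_one)
  show "tet_bracket (u + v) w = tet_bracket u w + tet_bracket v w"
    by transfer (rule lie_eq.Bracket_Add_left)
  show "tet_bracket u (v + w) = tet_bracket u v + tet_bracket u w"
    by transfer (rule lie_eq.Bracket_Add_right)
  show "tet_bracket (tet_scale a u) v = tet_scale a (tet_bracket u v)"
    by transfer (rule lie_eq.Bracket_Scale_left)
  show "tet_bracket u (tet_scale a v) = tet_scale a (tet_bracket u v)"
    by transfer (rule lie_eq.Bracket_Scale_right)
  show "tet_bracket u u = 0"
    by transfer (rule lie_eq.Bracket_self)
  show "tet_bracket u (tet_bracket v w) + tet_bracket v (tet_bracket w u)
      + tet_bracket w (tet_bracket u v) = 0"
    by transfer (rule lie_eq.Jacobi)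
qed

text \<open>Both orders of the complementary pair \<open>k\<close>, \<open>h\<close> are demanded; the two conditions are
  equivalent since \<open>tet_x h k = - tet_x k h\<close>.\<close>

definition tet_X :: "4 \<Rightarrow> 4 \<Rightarrow> 'k::field tetrahedron set" where
  "tet_X i j = {\<xi>. tet_bracket (tet_x i j) \<xi> = 0 \<and>
     (\<forall>k h. {h, i, j, k} = UNIV \<longrightarrow>
        tet_bracket (tet_x k h) (tet_bracket (tet_x k h) (tet_bracket (tet_x k h) \<xi>))
        = tet_scale 4 (tet_bracket (tet_x k h) \<xi>))}"


section \<open>The algebra \<open>F[t, 1/t, 1/(t - 1)]\<close>\<close>

definition fract_const :: "'k::field \<Rightarrow> 'k poly fract" where
  "fract_const c = to_fract [:c:]"

definition fract_t :: "'k::field poly fract" where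
  "fract_t = to_fract [:0, 1:]"

inductive_set loc_ring :: "'k::field poly fract set" where
  const: "fract_const c \<in> loc_ring"
| t: "fract_t \<in> loc_ring"
| inverse_t: "inverse fract_t \<in> loc_ring"
| inverse_t_minus_1: "inverse (fract_t - 1) \<in> loc_ring"
| add: "p \<in> loc_ring \<Longrightarrow> q \<in> loc_ring \<Longrightarrow> p + q \<in> loc_ring"
| mult: "p \<in> loc_ring \<Longrightarrow> q \<in> loc_ring \<Longrightarrow> p * q \<in> loc_ring"

lemma fract_const_simps [simp]:
  "fract_const 0 = 0" "fract_const 1 = 1"
  "fract_const (a + b) = fract_const a + fract_const b"
  "fract_const (a * b) = fract_const a * fract_const b"
  "fract_const (- a) = - fract_const a"
  unfolding fract_const_def
  by (simp_all flip: to_fract_add to_fract_mult to_fract_uminus one_pCons)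

lemma loc_ring_0: "0 \<in> loc_ring" and loc_ring_1: "1 \<in> loc_ring"
  using loc_ring.const[of 0] loc_ring.const[of 1] by simp_all

lemma loc_ring_uminus: "p \<in> loc_ring \<Longrightarrow> - p \<in> loc_ring"
  using loc_ring.mult[OF loc_ring.const[of "- 1"], of p] by simp

lemma loc_ring_diff: "p \<in> loc_ring \<Longrightarrow> q \<in> loc_ring \<Longrightarrow> p - q \<in> loc_ring"
  using loc_ring.add[OF _ loc_ring_uminus, of p q] by simp

typedef (overloaded) 'k loc = "loc_ring :: 'k::field poly fract set"
  using loc_ring_0 by blast

setup_lifting type_definition_loc

instantiation loc :: (field) comm_ring_1
begin

lift_definition zero_loc :: "'a loc" is 0 by (rule loc_ring_0)
lift_definition one_loc :: "'a loc" is 1 by (rule loc_ring_1)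
lift_definition plus_loc :: "'a loc \<Rightarrow> 'a loc \<Rightarrow> 'a loc" is "(+)" by (rule loc_ring.add)
lift_definition times_loc :: "'a loc \<Rightarrow> 'a loc \<Rightarrow> 'a loc" is "(*)" by (rule loc_ring.mult)
lift_definition uminus_loc :: "'a loc \<Rightarrow> 'a loc" is uminus by (rule loc_ring_uminus)
lift_definition minus_loc :: "'a loc \<Rightarrow> 'a loc \<Rightarrow> 'a loc" is "(-)" by (rule loc_ring_diff)

instance by standard (transfer; simp add: algebra_simps)+

end

lift_definition loc_const :: "'k::field \<Rightarrow> 'k loc" is fract_const by (rule loc_ring.const)

lift_definition loc_t :: "'k::field loc" is fract_t by (rule loc_ring.t)

lift_definition loc_t' :: "'k::field loc" is "1 - inverse fract_t"
  by (intro loc_ring_diff loc_ring_1 loc_ring.inverse_t)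

lift_definition loc_t'' :: "'k::field loc" is "inverse (1 - fract_t)"
  using loc_ring_uminus[OF loc_ring.inverse_t_minus_1] by (simp flip: inverse_minus_eq)


section \<open>\<open>sl\<^sub>2\<close> and \<open>sl\<^sub>2 \<otimes> F[t, 1/t, 1/(t - 1)]\<close>\<close>

text \<open>\<open>(a, b, c)\<close> stands for \<open>a e + b f + c h\<close>. As \<open>e, f, h\<close> is a basis of \<open>sl\<^sub>2\<close> over \<open>F\<close>, the tensor
  product of \<open>sl\<^sub>2\<close> with an \<open>F\<close>-algebra \<open>A\<close> is \<open>A sl2\<close>, with \<open>(a, b, c)\<close> standing for
  \<open>e \<otimes> a + f \<otimes> b + h \<otimes> c\<close>.\<close>

type_synonym 'r sl2 = "'r \<times> 'r \<times> 'r"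

definition sl2_e :: "'r::comm_ring_1 sl2" where "sl2_e = (1, 0, 0)"
definition sl2_f :: "'r::comm_ring_1 sl2" where "sl2_f = (0, 1, 0)"
definition sl2_h :: "'r::comm_ring_1 sl2" where "sl2_h = (0, 0, 1)"

fun sl2_scale :: "'r::comm_ring_1 \<Rightarrow> 'r sl2 \<Rightarrow> 'r sl2" where
  "sl2_scale r (a, b, c) = (r * a, r * b, r * c)"

fun sl2_bracket :: "'r::comm_ring_1 sl2 \<Rightarrow> 'r sl2 \<Rightarrow> 'r sl2" where
  "sl2_bracket (a, b, c) (a', b', c') =
     (2 * (c * a' - a * c'), - 2 * (c * b' - b * c'), a * b' - b * a')"

lemma sl2_bracket_basis:
  "sl2_bracket sl2_h sl2_e = sl2_scale 2 sl2_e"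
  "sl2_bracket sl2_h sl2_f = sl2_scale (- 2) sl2_f"
  "sl2_bracket sl2_e sl2_f = sl2_h"
  by (simp_all add: sl2_e_def sl2_f_def sl2_h_def)

definition sl2_x :: "'k::field sl2" where "sl2_x = sl2_scale 2 sl2_e - sl2_h"
definition sl2_y :: "'k::field sl2" where "sl2_y = sl2_scale (- 2) sl2_f - sl2_h"
definition sl2_z :: "'k::field sl2" where "sl2_z = sl2_h"

type_synonym 'k loop_sl2 = "'k loc sl2"

fun pure_tensor :: "'k::field sl2 \<Rightarrow> 'k loc \<Rightarrow> 'k loop_sl2" (infixr \<open>\<otimes>\<^sub>F\<close> 75) where
  "(a, b, c) \<otimes>\<^sub>F p = (loc_const a * p, loc_const b * p, loc_const c * p)"

definition loop_scale :: "'k::field \<Rightarrow> 'k loop_sl2 \<Rightarrow> 'k loop_sl2" where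
  "loop_scale r u = sl2_scale (loc_const r) u"

definition loop_bracket :: "'k::field loop_sl2 \<Rightarrow> 'k loop_sl2 \<Rightarrow> 'k loop_sl2" where
  "loop_bracket = sl2_bracket"

definition loop_act :: "'k::field loop_sl2 \<Rightarrow> 'k loc \<Rightarrow> 'k loop_sl2" (infixl \<open>\<cdot>\<^sub>A\<close> 74) where
  "u \<cdot>\<^sub>A p = sl2_scale p u"

lemma loc_const_simps [simp]:
  "loc_const 0 = 0" "loc_const 1 = 1"
  "loc_const (a + b) = loc_const a + loc_const b"
  "loc_const (a * b) = loc_const a * loc_const b"
  "loc_const (- a) = - loc_const a"
  by (transfer; simp)+

lemma loc_const_diff [simp]: "loc_const (a - b) = loc_const a - loc_const b"
  using loc_const_simps(3)[of a "- b"] by (simp del: loc_const_simps(3))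

lemma loc_const_numeral [simp]: "loc_const (numeral n) = numeral n"
proof -
  have "loc_const (of_nat m) = of_nat m" for m by (induction m) simp_all
  from this[of "numeral n"] show ?thesis by simp
qed

lemma lie_algebra_loop: "lie_algebra loop_scale (loop_bracket :: 'k::field loop_sl2 \<Rightarrow> _)"
proof
  fix a b :: 'k and u v w :: "'k loop_sl2"
  obtain u1 u2 u3 v1 v2 v3 w1 w2 w3
    where [simp]: "u = (u1, u2, u3)" "v = (v1, v2, v3)" "w = (w1, w2, w3)"
    by (metis prod.exhaust)
  note [simp] = loop_scale_def loop_bracket_def zero_prod_def
  show "loop_scale a (u + v) = loop_scale a u + loop_scale a v"
    by (simp add: algebra_simps)
  show "loop_scale (a + b) u = loop_scale a u + loop_scale b u"
    by (simp add: algebra_simps)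
  show "loop_scale a (loop_scale b u) = loop_scale (a * b) u"
    by (simp add: algebra_simps)
  show "loop_scale 1 u = u"
    by simp
  show "loop_bracket (u + v) w = loop_bracket u w + loop_bracket v w"
    by (simp add: algebra_simps)
  show "loop_bracket u (v + w) = loop_bracket u v + loop_bracket u w"
    by (simp add: algebra_simps)
  show "loop_bracket (loop_scale a u) v = loop_scale a (loop_bracket u v)"
    by (simp add: algebra_simps)
  show "loop_bracket u (loop_scale a v) = loop_scale a (loop_bracket u v)"
    by (simp add: algebra_simps)
  show "loop_bracket u u = 0"
    by (simp add: algebra_simps)
  show "loop_bracket u (loop_bracket v w) + loop_bracket v (loop_bracket w u)
      + loop_bracket w (loop_bracket u v) = 0"
    by (simp add: algebra_simps)
qed

lemma pure_tensor_bracket: "loop_bracket (u \<otimes>\<^sub>F p) (v \<otimes>\<^sub>F q) = sl2_bracket u v \<otimes>\<^sub>F (p * q)"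
  by (cases u; cases v) (simp add: loop_bracket_def algebra_simps)

lemma pure_tensor_act: "(u \<otimes>\<^sub>F p) \<cdot>\<^sub>A q = u \<otimes>\<^sub>F (p * q)"
  by (cases u) (simp add: loop_act_def algebra_simps)

lemma pure_tensor_decomp: "(p, q, r) = sl2_e \<otimes>\<^sub>F p + sl2_f \<otimes>\<^sub>F q + sl2_h \<otimes>\<^sub>F r"
  by (simp add: sl2_e_def sl2_f_def sl2_h_def)


section \<open>The Onsager subalgebra and the three families\<close>

definition onsager_A :: "'k::field loop_sl2" where
  "onsager_A = sl2_x \<otimes>\<^sub>F 1"

definition onsager_B :: "'k::field loop_sl2" where
  "onsager_B = sl2_y \<otimes>\<^sub>F loc_t + sl2_z \<otimes>\<^sub>F (loc_t - 1)"

definition onsager :: "'k::field loop_sl2 set" where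
  "onsager = lie_generated loop_scale loop_bracket {onsager_A, onsager_B}"

text \<open>The defining property of \<open>\<sigma>\<close>; such a \<open>\<sigma>\<close> is unique because the \<open>tet_x i j\<close> generate.\<close>

definition is_sigma :: "('k::field tetrahedron \<Rightarrow> 'k loop_sl2) \<Rightarrow> bool" where
  "is_sigma \<sigma> \<longleftrightarrow>
     lie_isomorphism tet_scale tet_bracket loop_scale loop_bracket \<sigma> \<and>
     \<sigma> (tet_x 1 2) = sl2_x \<otimes>\<^sub>F 1 \<and>
     \<sigma> (tet_x 2 3) = sl2_y \<otimes>\<^sub>F 1 \<and>
     \<sigma> (tet_x 3 1) = sl2_z \<otimes>\<^sub>F 1 \<and>
     \<sigma> (tet_x 0 3) = sl2_y \<otimes>\<^sub>F loc_t + sl2_z \<otimes>\<^sub>F (loc_t - 1) \<and>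
     \<sigma> (tet_x 0 1) = sl2_z \<otimes>\<^sub>F loc_t' + sl2_x \<otimes>\<^sub>F (loc_t' - 1) \<and>
     \<sigma> (tet_x 0 2) = sl2_x \<otimes>\<^sub>F loc_t'' + sl2_y \<otimes>\<^sub>F (loc_t'' - 1)"

definition A_upup :: "nat \<Rightarrow> 'k::field loop_sl2" where
  "A_upup i = sl2_x \<otimes>\<^sub>F (loc_t - 1) ^ i"

definition B_upup :: "nat \<Rightarrow> 'k::field loop_sl2" where
  "B_upup i = (sl2_y \<otimes>\<^sub>F loc_t + sl2_z \<otimes>\<^sub>F (loc_t - 1)) \<cdot>\<^sub>A (loc_t - 1) ^ i"

definition psi_upup :: "nat \<Rightarrow> 'k::field loop_sl2" where
  "psi_upup i = sl2_z \<otimes>\<^sub>F (loc_t - 1) ^ i"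

end

(* Every sigma(x_ij) = (a, b, c) satisfies c^2 + ab = 1, so by Cayley-Hamilton its adjoint map
   satisfies ad^3 = 4 ad identically, and the image of X_ij is just the centralizer of sigma(x_ij).
   For x_12, x_03, x_31 this centralizer is the loc-line through A, B, z respectively. With
   s = t - 1, the relations
     [A, B] = 2A + 2B - 4zs,   [A, zs] = -2As - 2zs,   [B, zs] = 2Bs + 2zs
   extend linearly over polynomials in s, so O consists of the elements A p(s) + B q(s) + zs r(s);
   intersecting with the three lines kills two of the three summands. *)
theory Submission
  imports Defs
begin

section \<open>The ring \<open>\<A>\<close> and its subring of polynomials in \<open>t - 1\<close>\<close>

text \<open>Inherited from the surrounding fraction field. It allows nonzero factors such as
  \<open>loc_t\<close> or a coordinate of a vector to be cancelled.\<close>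

instance loc :: (field) idom
  by standard (transfer; simp)

lemma loc_const_eq_0_iff [simp]: "loc_const c = 0 \<longleftrightarrow> c = 0"
  by transfer (simp add: fract_const_def)

text \<open>Integers enter through the injective \<open>loc_const\<close>. This permits cancelling
  the factors 2 in the coordinates of \<open>onsager_A\<close> and \<open>onsager_B\<close>.\<close>

instance loc :: (field_char_0) ring_char_0
proof
  have of_nat: "of_nat n = loc_const (of_nat n :: 'a)" for n
    by (induction n) simp_all
  show "inj (of_nat :: nat \<Rightarrow> 'a loc)"
  proof (rule injI)
    fix m n
    assume "of_nat m = (of_nat n :: 'a loc)"
    then have "loc_const (of_nat m - of_nat n :: 'a) = 0"
      by (simp add: of_nat)
    then show "m = n"
      by (simp only: loc_const_eq_0_iff) simp
  qed
qed

lemma loc_t_nonzero [simp]: "loc_t \<noteq> 0"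
  by transfer (simp add: fract_t_def)

lemma loc_t_neq_1 [simp]: "loc_t \<noteq> 1"
  by transfer (simp add: fract_t_def one_pCons flip: to_fract_1)

lemma to_fract_pCons: "to_fract (pCons a p) = fract_const a + fract_t * to_fract p"
proof -
  have "pCons a p = [:a:] + [:0, 1:] * p" by simp
  then show ?thesis
    unfolding fract_const_def fract_t_def by (simp only: to_fract_add to_fract_mult)
qed

lemma to_fract_in_loc_ring: "to_fract p \<in> loc_ring"
  by (induction p) (auto simp: to_fract_pCons loc_ring_0 intro: loc_ring.intros)

text \<open>Evaluation at \<open>t - 1\<close> rather than at \<open>t\<close>, so that the monomial
  basis of polynomials maps onto the powers occurring in the three families.\<close>

lift_definition poly_t1 :: "'k::field poly \<Rightarrow> 'k loc" is "\<lambda>p. to_fract (p \<circ>\<^sub>p [:- 1, 1:])"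
  by (rule to_fract_in_loc_ring)

lemma poly_t1_simps [simp]:
  "poly_t1 0 = 0" "poly_t1 1 = 1"
  "poly_t1 (p + q) = poly_t1 p + poly_t1 q"
  "poly_t1 (p - q) = poly_t1 p - poly_t1 q"
  "poly_t1 (p * q) = poly_t1 p * poly_t1 q"
  by (transfer; simp add: pcompose_add pcompose_diff pcompose_mult pcompose_1)+

lemma poly_t1_const: "poly_t1 [:c:] = loc_const c"
  by transfer (simp add: fract_const_def)

lemma poly_t1_smult [simp]: "poly_t1 (smult c p) = loc_const c * poly_t1 p"
  using poly_t1_simps(5)[of "[:c:]" p] by (simp add: poly_t1_const)

lemma poly_t1_X [simp]: "poly_t1 [:0, 1:] = loc_t - 1"
  by transfer (simp add: fract_t_def pcompose_pCons one_pCons flip: to_fract_1 to_fract_diff)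

lemma poly_t1_monom [simp]: "poly_t1 (monom 1 i) = (loc_t - 1) ^ i"
proof (induction i)
  case 0
  then show ?case by (simp flip: one_pCons)
next
  case (Suc i)
  have "monom 1 (Suc i) = [:0, 1:] * monom (1 :: 'a) i" by (simp add: monom_Suc)
  then show ?case using Suc by (simp only: poly_t1_simps poly_t1_X power_Suc)
qed

text \<open>Composition with \<open>[:- 1, 1:]\<close>, of positive degree, is injective, and so is
  \<open>to_fract\<close>.\<close>

lemma poly_t1_eq_0_iff [simp]: "poly_t1 p = 0 \<longleftrightarrow> p = 0"
  by transfer (simp add: pcompose_eq_0_iff)


section \<open>Bases of monomials\<close>

lemma vector_space_smult: "vector_space (smult :: 'k::field \<Rightarrow> _)"
  by standard (simp_all add: smult_add_right smult_add_left)

lemma family_basis_monom: "family_basis smult (monom (1::'k::field)) UNIV"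
proof -
  interpret vector_space "smult :: 'k \<Rightarrow> _" by (rule vector_space_smult)
  have inj: "inj (monom (1::'k))"
    by (auto intro!: injI simp: monom_eq_iff')
  have "independent (range (monom (1::'k)))"
    unfolding independent_explicit_module
  proof (intro allI impI)
    fix T u v
    assume T: "finite T" "T \<subseteq> range (monom (1::'k))" "(\<Sum>w\<in>T. smult (u w) w) = 0" "v \<in> T"
    then obtain i where i: "v = monom 1 i" by auto
    \<comment> \<open>Coefficient \<open>i\<close> isolates \<open>u v\<close>: every other monomial
      in \<open>T\<close> has a degree different from \<open>i\<close>.\<close>
    have "0 = coeff (\<Sum>w\<in>T. smult (u w) w) i" using T by simp
    also have "\<dots> = (\<Sum>w\<in>T. u w * coeff w i)" by (simp add: coeff_sum)
    also have "\<dots> = (\<Sum>w\<in>T. if w = v then u w else 0)"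
      using T(2) by (intro sum.cong) (auto simp: i monom_eq_iff')
    also have "\<dots> = u v" using T by simp
    finally show "u v = 0" by simp
  qed
  moreover have "p \<in> span (range (monom 1))" for p :: "'k poly"
  proof -
    have "(\<Sum>i\<le>degree p. smult (coeff p i) (monom 1 i)) \<in> span (range (monom 1))"
      by (intro span_sum span_scale span_base) auto
    then show ?thesis by (simp add: smult_monom poly_as_sum_of_monoms)
  qed
  ultimately show ?thesis using inj by (auto simp: family_basis_def)
qed

lemma family_basis_image:
  assumes "Vector_Spaces.linear s1 s2 L" "inj L" "family_basis s1 v V"
  shows "family_basis s2 (\<lambda>i. L (v i)) (L ` V)"
proof -
  interpret Vector_Spaces.linear s1 s2 L by fact
  have "range (\<lambda>i. L (v i)) = L ` range v" by auto
  moreover have "inj (\<lambda>i. L (v i))"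
    using assms by (auto simp: family_basis_def inj_def)
  moreover have "vs2.independent (L ` range v)"
    using assms by (intro independent_injective_image) (auto simp: family_basis_def intro: inj_on_subset)
  ultimately show ?thesis
    using assms by (simp add: family_basis_def span_image)
qed

lemma vector_space_loop: "vector_space (loop_scale :: 'k::field \<Rightarrow> _)"
  using lie_algebra_loop lie_algebra.axioms(1) by blast

text \<open>All three families have this shape. The monomial basis is pushed forward along
  multiplication of \<open>v\<close>, which is injective because some coordinate of \<open>v\<close>
  is nonzero in a domain.\<close>

lemma family_basis_loop_act:
  fixes v :: "'k::field loop_sl2"
  assumes "v \<noteq> 0"
  shows "family_basis loop_scale (\<lambda>i. v \<cdot>\<^sub>A (loc_t - 1) ^ i) (range (\<lambda>p. v \<cdot>\<^sub>A poly_t1 p))"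
proof -
  obtain a b c where v: "v = (a, b, c)" by (cases v)
  have "Vector_Spaces.linear smult loop_scale (\<lambda>p. v \<cdot>\<^sub>A poly_t1 p)"
    unfolding Vector_Spaces.linear_iff
    by (simp add: vector_space_smult vector_space_loop v loop_act_def loop_scale_def algebra_simps)
  moreover have "inj (\<lambda>p. v \<cdot>\<^sub>A poly_t1 p)"
  proof (rule injI)
    fix p q
    assume "v \<cdot>\<^sub>A poly_t1 p = v \<cdot>\<^sub>A poly_t1 q"
    then have "poly_t1 (p - q) = 0"
      using assms by (auto simp: v loop_act_def zero_prod_def)
    then show "p = q" by (simp only: poly_t1_eq_0_iff) simp
  qed
  ultimately show ?thesis
    using family_basis_image[OF _ _ family_basis_monom] by fastforce
qed


section \<open>The Onsager algebra\<close>

text \<open>\<open>onsager\<close> contains this element but not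
  \<open>sl2_z \<otimes>\<^sub>F 1\<close>, whence the index shift in the third family.\<close>

abbreviation (input) psi_1 :: "'k::field loop_sl2" where
  "psi_1 \<equiv> sl2_z \<otimes>\<^sub>F (loc_t - 1)"

lemma onsager_A_coords: "onsager_A = (2, 0, - 1)"
  and onsager_B_coords: "onsager_B = (0, - 2 * loc_t, - 1)"
  and psi_1_coords: "psi_1 = (0, 0, loc_t - 1)"
  by (simp_all add: onsager_A_def onsager_B_def sl2_x_def sl2_y_def sl2_z_def
      sl2_e_def sl2_f_def sl2_h_def)

lemmas onsager_coords = onsager_A_coords onsager_B_coords psi_1_coords

lemma A_upup_act: "A_upup = (\<lambda>i. onsager_A \<cdot>\<^sub>A (loc_t - 1) ^ i)"
  and B_upup_act: "B_upup = (\<lambda>i. onsager_B \<cdot>\<^sub>A (loc_t - 1) ^ i)"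
  and psi_upup_act: "(\<lambda>i. psi_upup (i + 1)) = (\<lambda>i. psi_1 \<cdot>\<^sub>A (loc_t - 1) ^ i)"
  by (simp_all add: fun_eq_iff A_upup_def B_upup_def psi_upup_def onsager_A_def onsager_B_def
      pure_tensor_act)

text \<open>The right-hand side is closed under brackets and contains both generators, which bounds
  \<open>onsager\<close> from above. Conversely, recurrences put all its elements into any
  subalgebra containing the generators.\<close>

lemma onsager_eq:
  "(onsager :: 'k::field_char_0 loop_sl2 set) =
     {onsager_A \<cdot>\<^sub>A poly_t1 p + onsager_B \<cdot>\<^sub>A poly_t1 q + psi_1 \<cdot>\<^sub>A poly_t1 r | p q r. True}"
  (is "_ = ?O")
proof
  interpret L: lie_algebra "loop_scale :: 'k \<Rightarrow> _" loop_bracket by (rule lie_algebra_loop)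
  define elt :: "'k poly \<Rightarrow> 'k poly \<Rightarrow> 'k poly \<Rightarrow> 'k loop_sl2" where
    "elt p q r = onsager_A \<cdot>\<^sub>A poly_t1 p + onsager_B \<cdot>\<^sub>A poly_t1 q + psi_1 \<cdot>\<^sub>A poly_t1 r" for p q r
  have O: "?O = {elt p q r | p q r. True}" by (simp add: elt_def)
  have elt: "elt p q r = (2 * poly_t1 p, - 2 * loc_t * poly_t1 q,
      - poly_t1 p - poly_t1 q + (loc_t - 1) * poly_t1 r)" for p q r
    unfolding elt_def onsager_coords by (simp add: loop_act_def algebra_simps)
  \<comment> \<open>The bracket is bilinear and alternating, so only the 2x2 minors
    \<open>d1\<close>, \<open>d2\<close>, \<open>d3\<close> of the two coefficient triples matter;
    they multiply [A, B], [A, \<open>psi_1\<close>] and [B, \<open>psi_1\<close>]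
    respectively.\<close>
  have bracket: "loop_bracket (elt p q r) (elt p' q' r') =
      elt (smult 2 d1 - smult 2 ([:0, 1:] * d2)) (smult 2 d1 + smult 2 ([:0, 1:] * d3))
        (smult 2 d3 - smult 2 d2 - smult 4 d1)"
    if "d1 = p * q' - q * p'" "d2 = p * r' - r * p'" "d3 = q * r' - r * q'"
    for p q r p' q' r' d1 d2 d3
    unfolding elt that loop_bracket_def
    by (simp only: poly_t1_simps poly_t1_smult poly_t1_X loc_const_numeral sl2_bracket.simps prod.inject
        mult_minus_left)
      (intro conjI; algebra)
  have "lie_subalgebra loop_scale loop_bracket ?O"
    unfolding lie_subalgebra_def L.subspace_def O
  proof (intro conjI ballI allI)
    have "0 = elt 0 0 0" by (simp add: elt zero_prod_def)
    then show "0 \<in> {elt p q r | p q r. True}" by blast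
  next
    fix u v :: "'k loop_sl2"
    assume "u \<in> {elt p q r | p q r. True}" "v \<in> {elt p q r | p q r. True}"
    then obtain p q r p' q' r' where uv: "u = elt p q r" "v = elt p' q' r'" by blast
    have "u + v = elt (p + p') (q + q') (r + r')"
      by (simp add: uv elt algebra_simps)
    then show "u + v \<in> {elt p q r | p q r. True}" by blast
    show "loop_bracket u v \<in> {elt p q r | p q r. True}"
      unfolding uv using bracket[OF HOL.refl HOL.refl HOL.refl] by blast
  next
    fix c and u :: "'k loop_sl2"
    assume "u \<in> {elt p q r | p q r. True}"
    then obtain p q r where u: "u = elt p q r" by blast
    have "loop_scale c u = elt (smult c p) (smult c q) (smult c r)"
      by (simp add: u elt loop_scale_def algebra_simps)
    then show "loop_scale c u \<in> {elt p q r | p q r. True}" by blast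
  qed
  moreover have "onsager_A = elt 1 0 0" "onsager_B = elt 0 1 0"
    by (simp_all add: elt onsager_coords)
  then have "{onsager_A, onsager_B} \<subseteq> ?O" unfolding O by blast
  ultimately show "onsager \<subseteq> ?O"
    unfolding onsager_def lie_generated_def by (intro hull_minimal)

  show "?O \<subseteq> onsager"
    unfolding onsager_def lie_generated_def hull_def
  proof (intro Inter_greatest)
    fix W :: "'k loop_sl2 set"
    assume "W \<in> {t. lie_subalgebra loop_scale loop_bracket t \<and> {onsager_A, onsager_B} \<subseteq> t}"
    then have W: "L.subspace W" and br: "\<And>u v. u \<in> W \<Longrightarrow> v \<in> W \<Longrightarrow> loop_bracket u v \<in> W"
      and AB: "onsager_A \<in> W" "onsager_B \<in> W"
      by (auto simp: lie_subalgebra_def)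
    note closed = L.subspace_add[OF W] L.subspace_diff[OF W] L.subspace_scale[OF W] br
    let ?A = "\<lambda>i. (onsager_A :: 'k loop_sl2) \<cdot>\<^sub>A (loc_t - 1) ^ i"
      and ?B = "\<lambda>i. (onsager_B :: 'k loop_sl2) \<cdot>\<^sub>A (loc_t - 1) ^ i"
      and ?P = "\<lambda>i. (psi_1 :: 'k loop_sl2) \<cdot>\<^sub>A (loc_t - 1) ^ i"
    have unscale: "u \<in> W" if "loop_scale c u \<in> W" "c \<noteq> 0" for c u
      using L.subspace_scale[OF W that(1), of "inverse c"] that(2) by simp
    \<comment> \<open>The three bracket relations solved for the new element: level \<open>i\<close>
      of A and B yields \<open>?P i\<close>, which yields level \<open>Suc i\<close> of A and B. The
      factors 4 and 2 are removed by \<open>unscale\<close>.\<close>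
    have P: "loop_scale 4 (?P i) = loop_scale 2 (?A i + ?B i) - loop_bracket (?A i) onsager_B" for i
      unfolding onsager_coords loop_act_def loop_bracket_def loop_scale_def
      by (simp add: algebra_simps)
    have A: "loop_scale 2 (?A (Suc i)) = - loop_bracket onsager_A (?P i) - loop_scale 2 (?P i)" for i
      unfolding onsager_coords loop_act_def loop_bracket_def loop_scale_def
      by (simp add: algebra_simps)
    have B: "loop_scale 2 (?B (Suc i)) = loop_bracket onsager_B (?P i) - loop_scale 2 (?P i)" for i
      unfolding onsager_coords loop_act_def loop_bracket_def loop_scale_def
      by (simp add: algebra_simps)
    have P_in: "?P i \<in> W" if "?A i \<in> W" "?B i \<in> W" for i
      by (rule unscale[of 4], unfold P) (simp_all add: that AB closed)
    have AB_in: "?A i \<in> W \<and> ?B i \<in> W" for i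
    proof (induction i)
      case 0
      then show ?case using AB by (simp add: onsager_coords loop_act_def)
    next
      case (Suc i)
      have "loop_scale 2 (?A (Suc i)) \<in> W" "loop_scale 2 (?B (Suc i)) \<in> W"
        unfolding A B using Suc P_in[of i] AB by (simp_all add: closed L.subspace_neg[OF W])
      then show ?case by (auto intro: unscale[of 2])
    qed
    \<comment> \<open>Passes from powers of \<open>t - 1\<close> to all polynomials in it, by the
      spanning half of the basis lemma.\<close>
    have range_sub: "range (\<lambda>p. v \<cdot>\<^sub>A poly_t1 p) \<subseteq> W"
      if "v \<noteq> 0" "\<And>i. v \<cdot>\<^sub>A (loc_t - 1) ^ i \<in> W" for v
    proof -
      have "range (\<lambda>p. v \<cdot>\<^sub>A poly_t1 p) = L.span (range (\<lambda>i. v \<cdot>\<^sub>A (loc_t - 1) ^ i))"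
        using family_basis_loop_act[OF that(1)] by (simp add: family_basis_def)
      also have "\<dots> \<subseteq> W" using that(2) W by (intro L.span_minimal) auto
      finally show ?thesis .
    qed
    have "range (\<lambda>p. onsager_A \<cdot>\<^sub>A poly_t1 p) \<subseteq> W" "range (\<lambda>p. onsager_B \<cdot>\<^sub>A poly_t1 p) \<subseteq> W"
      "range (\<lambda>p. psi_1 \<cdot>\<^sub>A poly_t1 p) \<subseteq> W"
      using AB_in P_in by (intro range_sub; simp add: onsager_coords zero_prod_def)+
    then show "?O \<subseteq> W" by (blast intro: L.subspace_add[OF W])
  qed
qed


section \<open>The spaces \<open>X\<^sub>i\<^sub>j\<close> as centralizers\<close>

text \<open>Serves to treat both orders of the complementary pair in \<open>tet_X\<close>.\<close>

lemma tet_x_minus: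
  assumes "i \<noteq> j"
  shows "tet_x j i = (- tet_x i j :: 'k::field tetrahedron)"
proof -
  have "tet_x i j + tet_x j i = (0 :: 'k::field tetrahedron)"
    using assms by (transfer fixing: i j) (intro lie_eq.rel tet_rel.intros)
  then show ?thesis
    by (simp add: eq_neg_iff_add_eq_0 add.commute)
qed

text \<open>One eighth of the Killing form.\<close>

fun sl2_form :: "'r::comm_ring_1 sl2 \<Rightarrow> 'r" where
  "sl2_form (a, b, c) = c * c + a * b"

text \<open>As a traceless 2x2 matrix, \<open>v\<close> squares to \<open>sl2_form v\<close> times
  the identity; expanding the triple commutator then leaves four times that scalar times the
  commutator.\<close>

lemma sl2_bracket_cubed:
  fixes u v :: "'r::comm_ring_1 sl2"
  shows "sl2_bracket v (sl2_bracket v (sl2_bracket v u)) = sl2_scale (4 * sl2_form v) (sl2_bracket v u)"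
proof -
  obtain a b c a' b' c' where v: "v = (a, b, c)" and u: "u = (a', b', c')"
    by (metis prod.exhaust)
  show ?thesis
    unfolding v u sl2_bracket.simps sl2_form.simps sl2_scale.simps prod.inject
    by (intro conjI; simp add: ring_distribs; simp add: ac_simps)
qed

lemma sl2_form_uminus [simp]: "sl2_form (- v) = sl2_form v"
  by (cases v) simp

text \<open>Form value 1 makes the cubic condition in \<open>tet_X\<close> automatic, so only the
  centralizer condition remains, and the isomorphism transports it.\<close>

lemma sigma_image_tet_X:
  fixes \<sigma> :: "'k::field tetrahedron \<Rightarrow> 'k loop_sl2"
  assumes iso: "lie_isomorphism tet_scale tet_bracket loop_scale loop_bracket \<sigma>"
    and kh: "distinct [h, i, j, k]" and form: "sl2_form (\<sigma> (tet_x k h)) = 1"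
  shows "\<sigma> ` tet_X i j = {u. loop_bracket (\<sigma> (tet_x i j)) u = 0}"
proof -
  have \<sigma>_bracket: "\<sigma> (tet_bracket u v) = loop_bracket (\<sigma> u) (\<sigma> v)" for u v
    using iso by (simp add: lie_isomorphism_def)
  have lin: "Vector_Spaces.linear tet_scale loop_scale \<sigma>" and bij: "bij \<sigma>"
    using iso by (simp_all add: lie_isomorphism_def)
  interpret Vector_Spaces.linear tet_scale loop_scale \<sigma> by (rule lin)
  have cubed: "tet_bracket (tet_x k' h') (tet_bracket (tet_x k' h') (tet_bracket (tet_x k' h') \<xi>))
        = tet_scale 4 (tet_bracket (tet_x k' h') \<xi>)" if UNIV: "{h', i, j, k'} = UNIV"
    for k' h' and \<xi> :: "'k tetrahedron"
  proof -
    \<comment> \<open>Only the two orders of the complementary pair are possible, and they differ by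
      a sign, under which \<open>sl2_form\<close> is invariant.\<close>
    have "h' = h \<and> k' = k \<or> h' = k \<and> k' = h"
      using kh UNIV_I[of h] UNIV_I[of k] unfolding UNIV[symmetric] by auto
    then have "sl2_form (\<sigma> (tet_x k' h')) = 1"
      using form kh tet_x_minus[of k h, where 'k = 'k] by (auto simp: neg)
    then have "\<sigma> (tet_bracket (tet_x k' h') (tet_bracket (tet_x k' h') (tet_bracket (tet_x k' h') \<xi>)))
        = \<sigma> (tet_scale 4 (tet_bracket (tet_x k' h') \<xi>))"
      by (simp add: \<sigma>_bracket scale loop_bracket_def sl2_bracket_cubed loop_scale_def)
    then show ?thesis using bij by (simp add: bij_def inj_def)
  qed
  then have X: "tet_X i j = {\<xi> :: 'k tetrahedron. tet_bracket (tet_x i j) \<xi> = 0}"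
    by (auto simp: tet_X_def)
  have "tet_bracket (tet_x i j) \<xi> = 0 \<longleftrightarrow> loop_bracket (\<sigma> (tet_x i j)) (\<sigma> \<xi>) = 0" for \<xi>
    using bij zero by (metis \<sigma>_bracket bij_def injD)
  then show ?thesis
    unfolding X using bij by (auto simp: bij_def image_iff) (metis surjD)
qed

lemma centralizer_A:
  "{u. loop_bracket onsager_A u = 0} = range ((\<cdot>\<^sub>A) (onsager_A :: 'k::field_char_0 loop_sl2))"
proof (intro equalityI subsetI)
  fix u :: "'k loop_sl2"
  assume *: "u \<in> {u. loop_bracket onsager_A u = 0}"
  obtain a b c where u: "u = (a, b, c)" by (cases u)
  have "b = 0" "- a = 2 * c"
    using * by (simp_all add: u onsager_coords loop_bracket_def zero_prod_def algebra_simps)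
  then have "b = 0" "a = - (2 * c)"
    by (simp_all add: minus_equation_iff[of a])
  \<comment> \<open>The \<open>h\<close>-coordinate of \<open>onsager_A\<close> is -1, which forces
    the multiplier \<open>- c\<close>; the same holds for \<open>onsager_B\<close>.\<close>
  then have "u = onsager_A \<cdot>\<^sub>A (- c)"
    by (simp add: u onsager_coords loop_act_def)
  then show "u \<in> range ((\<cdot>\<^sub>A) onsager_A)" by blast
qed (auto simp: onsager_coords loop_bracket_def loop_act_def zero_prod_def)

lemma centralizer_B:
  "{u. loop_bracket onsager_B u = 0} = range ((\<cdot>\<^sub>A) (onsager_B :: 'k::field_char_0 loop_sl2))"
proof (intro equalityI subsetI)
  fix u :: "'k loop_sl2"
  assume *: "u \<in> {u. loop_bracket onsager_B u = 0}"
  obtain a b c where u: "u = (a, b, c)" by (cases u)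
  have "a = 0" "b = 2 * loc_t * c"
    using * by (simp_all add: u onsager_coords loop_bracket_def zero_prod_def algebra_simps)
  then have "u = onsager_B \<cdot>\<^sub>A (- c)"
    by (simp add: u onsager_coords loop_act_def)
  then show "u \<in> range ((\<cdot>\<^sub>A) onsager_B)" by blast
qed (auto simp: onsager_coords loop_bracket_def loop_act_def zero_prod_def)

lemma centralizer_z:
  "{u. loop_bracket (sl2_z \<otimes>\<^sub>F 1) u = 0} = range ((\<otimes>\<^sub>F) (sl2_z :: 'k::field_char_0 sl2))"
  by (auto simp: sl2_z_def sl2_h_def loop_bracket_def zero_prod_def image_iff)


section \<open>Intersecting with the Onsager algebra\<close>

lemma centralizer_A_Int_onsager:
  "range ((\<cdot>\<^sub>A) onsager_A) \<inter> onsager =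
     range (\<lambda>p. (onsager_A :: 'k::field_char_0 loop_sl2) \<cdot>\<^sub>A poly_t1 p)"
proof (intro equalityI subsetI)
  fix u :: "'k loop_sl2"
  assume "u \<in> range ((\<cdot>\<^sub>A) onsager_A) \<inter> onsager"
  then obtain a p q r where "u = onsager_A \<cdot>\<^sub>A a"
    and "u = onsager_A \<cdot>\<^sub>A poly_t1 p + onsager_B \<cdot>\<^sub>A poly_t1 q + psi_1 \<cdot>\<^sub>A poly_t1 r"
    unfolding onsager_eq by blast
  \<comment> \<open>Among the three summands only the first has an \<open>e\<close>-coordinate;
    comparing it and cancelling 2 gives \<open>a = poly_t1 p\<close>.\<close>
  then have "u = onsager_A \<cdot>\<^sub>A poly_t1 p"
    unfolding onsager_coords by (auto simp: loop_act_def)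
  then show "u \<in> range (\<lambda>p. onsager_A \<cdot>\<^sub>A poly_t1 p)" by blast
next
  fix u :: "'k loop_sl2"
  assume "u \<in> range (\<lambda>p. onsager_A \<cdot>\<^sub>A poly_t1 p)"
  then obtain p where p: "u = onsager_A \<cdot>\<^sub>A poly_t1 p" by blast
  then have "u = onsager_A \<cdot>\<^sub>A poly_t1 p + onsager_B \<cdot>\<^sub>A poly_t1 0 + psi_1 \<cdot>\<^sub>A poly_t1 0"
    by (simp add: onsager_coords loop_act_def)
  then show "u \<in> range ((\<cdot>\<^sub>A) onsager_A) \<inter> onsager"
    unfolding onsager_eq using p by blast
qed

lemma centralizer_B_Int_onsager:
  "range ((\<cdot>\<^sub>A) onsager_B) \<inter> onsager =
     range (\<lambda>p. (onsager_B :: 'k::field_char_0 loop_sl2) \<cdot>\<^sub>A poly_t1 p)"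
proof (intro equalityI subsetI)
  fix u :: "'k loop_sl2"
  assume "u \<in> range ((\<cdot>\<^sub>A) onsager_B) \<inter> onsager"
  then obtain a p q r where "u = onsager_B \<cdot>\<^sub>A a"
    and "u = onsager_A \<cdot>\<^sub>A poly_t1 p + onsager_B \<cdot>\<^sub>A poly_t1 q + psi_1 \<cdot>\<^sub>A poly_t1 r"
    unfolding onsager_eq by blast
  \<comment> \<open>Here the \<open>f\<close>-coordinate decides, after cancelling
    \<open>2 * loc_t\<close>.\<close>
  then have "u = onsager_B \<cdot>\<^sub>A poly_t1 q"
    unfolding onsager_coords by (auto simp: loop_act_def)
  then show "u \<in> range (\<lambda>p. onsager_B \<cdot>\<^sub>A poly_t1 p)" by blast
next
  fix u :: "'k loop_sl2"
  assume "u \<in> range (\<lambda>p. onsager_B \<cdot>\<^sub>A poly_t1 p)"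
  then obtain p where p: "u = onsager_B \<cdot>\<^sub>A poly_t1 p" by blast
  then have "u = onsager_A \<cdot>\<^sub>A poly_t1 0 + onsager_B \<cdot>\<^sub>A poly_t1 p + psi_1 \<cdot>\<^sub>A poly_t1 0"
    by (simp add: onsager_coords loop_act_def)
  then show "u \<in> range ((\<cdot>\<^sub>A) onsager_B) \<inter> onsager"
    unfolding onsager_eq using p by blast
qed

lemma centralizer_z_Int_onsager:
  "range ((\<otimes>\<^sub>F) sl2_z) \<inter> onsager =
     range (\<lambda>p. (psi_1 :: 'k::field_char_0 loop_sl2) \<cdot>\<^sub>A poly_t1 p)"
proof (intro equalityI subsetI)
  fix u :: "'k loop_sl2"
  assume "u \<in> range ((\<otimes>\<^sub>F) sl2_z) \<inter> onsager"
  then obtain a p q r where "u = sl2_z \<otimes>\<^sub>F a"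
    and "u = onsager_A \<cdot>\<^sub>A poly_t1 p + onsager_B \<cdot>\<^sub>A poly_t1 q + psi_1 \<cdot>\<^sub>A poly_t1 r"
    unfolding onsager_eq by blast
  \<comment> \<open>Vanishing \<open>e\<close>- and \<open>f\<close>-coordinates of \<open>u\<close>
    make the first two summands zero.\<close>
  then have "u = psi_1 \<cdot>\<^sub>A poly_t1 r"
    unfolding onsager_coords by (simp add: loop_act_def sl2_z_def sl2_h_def)
  then show "u \<in> range (\<lambda>p. psi_1 \<cdot>\<^sub>A poly_t1 p)" by blast
next
  fix u :: "'k loop_sl2"
  assume "u \<in> range (\<lambda>p. psi_1 \<cdot>\<^sub>A poly_t1 p)"
  then obtain p where p: "u = psi_1 \<cdot>\<^sub>A poly_t1 p" by blast
  then have "u = onsager_A \<cdot>\<^sub>A poly_t1 0 + onsager_B \<cdot>\<^sub>A poly_t1 0 + psi_1 \<cdot>\<^sub>A poly_t1 p"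
    unfolding onsager_coords by (simp add: loop_act_def)
  moreover have "u = sl2_z \<otimes>\<^sub>F ((loc_t - 1) * poly_t1 p)"
    by (simp add: p pure_tensor_act)
  ultimately show "u \<in> range ((\<otimes>\<^sub>F) sl2_z) \<inter> onsager"
    unfolding onsager_eq by blast
qed

theorem lemma6p2:
  fixes \<sigma> :: "'k::field_char_0 tetrahedron \<Rightarrow> 'k loop_sl2"
  assumes "is_sigma \<sigma>"
  shows "family_basis loop_scale A_upup (\<sigma> ` tet_X 1 2 \<inter> onsager) \<and>
    family_basis loop_scale B_upup (\<sigma> ` tet_X 0 3 \<inter> onsager) \<and>
    family_basis loop_scale (\<lambda>i. psi_upup (i + 1)) (\<sigma> ` tet_X 3 1 \<inter> onsager)"
proof -
  have iso: "lie_isomorphism tet_scale tet_bracket loop_scale loop_bracket \<sigma>"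
    and x12: "\<sigma> (tet_x 1 2) = onsager_A" and x03: "\<sigma> (tet_x 0 3) = onsager_B"
    and x31: "\<sigma> (tet_x 3 1) = sl2_z \<otimes>\<^sub>F 1"
    and x02: "\<sigma> (tet_x 0 2) = sl2_x \<otimes>\<^sub>F loc_t'' + sl2_y \<otimes>\<^sub>F (loc_t'' - 1)"
    using assms by (simp_all add: is_sigma_def onsager_A_def onsager_B_def)
  have "sl2_form (\<sigma> (tet_x 0 3)) = 1" "sl2_form (\<sigma> (tet_x 1 2)) = 1"
    by (simp_all add: x12 x03 onsager_coords)
  \<comment> \<open>With s = \<open>loc_t''\<close> this is the identity (1 - 2s)^2 + 4s(1 - s) =
    1.\<close>
  moreover have "sl2_form (\<sigma> (tet_x 0 2)) = 1"
    by (simp add: x02 sl2_x_def sl2_y_def sl2_e_def sl2_f_def sl2_h_def algebra_simps)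
  ultimately have
    "\<sigma> ` tet_X 1 2 = range ((\<cdot>\<^sub>A) onsager_A)"
    "\<sigma> ` tet_X 0 3 = range ((\<cdot>\<^sub>A) onsager_B)"
    "\<sigma> ` tet_X 3 1 = range ((\<otimes>\<^sub>F) sl2_z)"
    \<comment> \<open>The arguments are \<open>h i j k\<close>, ordered so that
      \<open>tet_x k h\<close> is \<open>tet_x 0 3\<close>, \<open>tet_x 1 2\<close> and
      \<open>tet_x 0 2\<close>, whose images \<open>is_sigma\<close> prescribes.\<close>
    using sigma_image_tet_X[OF iso, of 3 1 2 0] sigma_image_tet_X[OF iso, of 2 0 3 1]
      sigma_image_tet_X[OF iso, of 2 3 1 0]
    by (simp_all add: x12 x03 x31 centralizer_A centralizer_B centralizer_z)
  moreover have "onsager_A \<noteq> (0 :: 'k loop_sl2)" "onsager_B \<noteq> (0 :: 'k loop_sl2)"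
    "psi_1 \<noteq> (0 :: 'k loop_sl2)"
    unfolding onsager_coords by (simp_all add: zero_prod_def)
  \<comment> \<open>\<open>psi_1\<close> must stay an unevaluated tensor to match the lemmas, and
    its index is put in the form \<open>Suc i\<close> that simplification produces.\<close>
  ultimately show ?thesis
    by (simp add: centralizer_A_Int_onsager centralizer_B_Int_onsager centralizer_z_Int_onsager
        A_upup_act B_upup_act psi_upup_act[folded Suc_eq_plus1] family_basis_loop_act
        del: pure_tensor.simps)
qed

end
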